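(* There is an absolute constant $c>0$ such that the following holds. Consider any deterministic leader election algorithm $ELECT$ with advice such that, for every tree $T$ of positive even diameter, $ELECT$ solves leader election in $T$ within $diam(T)-2$ rounds. Then for every integer $D\ge 4$ there exists a tree $T$ with even diameter $diam(T)\le D$ and $\xi(T)\le diam(T)-2$ for which $ELECT$ requires advice of size at least $c\log D$ (i.e., of size $\Omega(\log D)$).
   Context: Trees are finite, undirected and anonymous (nodes have no labels), and are port-numbered: at each node $v$ of degree $d$ the incident edges carry distinct port numbers from $\{0,\dots,d-1\}$; there is no relation between the two port numbers of an edge at its two endpoints. $diam(T)$ is the diameter of $T$. Leader election in $T$: every node $v$ must output a finite sequence $P(v)=(p_1,\dots,p_k)$ of nonnegative integers (possibly empty). Let $P^*(v)$ be the path starting at $v$ obtained by taking $p_i$ as the outgoing port at the $i$-th node of the path. All $P^*(v)$ must be simple paths in $T$ ending at one common node (the leader). View: $V_T(v,r)$ is the subtree of $T$ induced by all nodes at distance at most $r$ from $v$, rooted at $v$, with all port numbers at these nodes and with the degrees of all nodes at distance exactly $r$ from $v$ (views are identified up to root- and port-preserving isomorphism). Deterministic algorithm with advice (LOCAL model): an oracle knowing $T$ assigns to $T$ one binary string $A(T)$, given to all nodes at the start; the size of advice for $T$ is the length of $A(T)$. After each round $r\ge 0$, each node $v$ that has not yet halted decides, as a function of $V_T(v,r)$ and $A(T)$ only, whether to halt and what to output. The algorithm works in time $\tau$ on $T$ (solves the task within $\tau$ rounds) if all nodes halt in rounds at most $\tau$. "Requires advice of size at least $s$ for $T$" means that the length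 of $A(T)$ is at least $s$. $\xi(T)$ is the minimum time in which leader election in $T$ is feasible when each node is given the entire port-numbered map of $T$ (without its own position marked), i.e., the smallest $\tau$ for which there is a valid assignment of outputs in $T$ in which the output of each node $v$ depends only on $V_T(v,\tau)$. *)

theory Defs
  imports Complex_Main "HOL-Library.Extended_Nat"
begin

(* Nodes are named by natural numbers only to have carriers; the names are factored out
   below by passing to isomorphism classes. port T u v is the port number at u of the
   edge uv; its values at non-edges are irrelevant and are ignored by isomorphisms. *)
record ptree =
  nodes :: "nat set"
  adj :: "nat \<Rightarrow> nat \<Rightarrow> bool"
  port :: "nat \<Rightarrow> nat \<Rightarrow> nat"

definition deg :: "'z ptree_scheme \<Rightarrow> nat \<Rightarrow> nat" where
  "deg T v = card {u. adj T v u}"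

definition walk :: "'z ptree_scheme \<Rightarrow> nat \<Rightarrow> nat \<Rightarrow> nat list \<Rightarrow> bool" where
  "walk T u v xs \<longleftrightarrow> xs \<noteq> [] \<and> set xs \<subseteq> nodes T \<and> successively (adj T) xs \<and>
     hd xs = u \<and> last xs = v"

definition cycle :: "'z ptree_scheme \<Rightarrow> nat list \<Rightarrow> bool" where
  "cycle T xs \<longleftrightarrow> length xs \<ge> 3 \<and> distinct xs \<and> successively (adj T) xs \<and> adj T (last xs) (hd xs)"

definition port_tree :: "'z ptree_scheme \<Rightarrow> bool" where
  "port_tree T \<longleftrightarrow>
     finite (nodes T) \<and> nodes T \<noteq> {} \<and>
     (\<forall>u v. adj T u v \<longrightarrow> u \<in> nodes T \<and> v \<in> nodes T \<and> u \<noteq> v \<and> adj T v u) \<and>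
     (\<forall>u\<in>nodes T. \<forall>v\<in>nodes T. \<exists>xs. walk T u v xs) \<and>
     (\<nexists>xs. cycle T xs) \<and>
     (\<forall>v\<in>nodes T. bij_betw (port T v) {u. adj T v u} {0..<deg T v})"

definition gdist :: "'z ptree_scheme \<Rightarrow> nat \<Rightarrow> nat \<Rightarrow> nat" where
  "gdist T u v = (LEAST n. \<exists>xs. walk T u v xs \<and> length xs = Suc n)"

definition diam :: "'z ptree_scheme \<Rightarrow> nat" where
  "diam T = Max {gdist T u v | u v. u \<in> nodes T \<and> v \<in> nodes T}"

definition port_iso :: "(nat \<Rightarrow> nat) \<Rightarrow> 'y ptree_scheme \<Rightarrow> 'z ptree_scheme \<Rightarrow> bool" where
  "port_iso f S T \<longleftrightarrow>
     bij_betw f (nodes S) (nodes T) \<and>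
     (\<forall>u\<in>nodes S. \<forall>v\<in>nodes S.
        (adj S u v \<longleftrightarrow> adj T (f u) (f v)) \<and>
        (adj S u v \<longrightarrow> port S u v = port T (f u) (f v)))"

definition anon_tree :: "ptree \<Rightarrow> ptree set" where
  "anon_tree T = {T'. \<exists>f. port_iso f T T'}"

record rooted_view = ptree +
  vroot :: nat
  vdeg :: "nat \<Rightarrow> nat option"

definition view_rep :: "ptree \<Rightarrow> nat \<Rightarrow> nat \<Rightarrow> rooted_view" where
  "view_rep T v r =
     (let B = {x \<in> nodes T. gdist T v x \<le> r} in
      \<lparr> nodes = B,
        adj = (\<lambda>x y. x \<in> B \<and> y \<in> B \<and> adj T x y),
        port = port T,
        vroot = v,
        vdeg = (\<lambda>x. if x \<in> B \<and> gdist T v x = r then Some (deg T x) else None) \<rparr>)"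

definition view_iso :: "(nat \<Rightarrow> nat) \<Rightarrow> rooted_view \<Rightarrow> rooted_view \<Rightarrow> bool" where
  "view_iso f S S' \<longleftrightarrow>
     port_iso f S S' \<and> f (vroot S) = vroot S' \<and> (\<forall>x\<in>nodes S. vdeg S x = vdeg S' (f x))"

definition view :: "ptree \<Rightarrow> nat \<Rightarrow> nat \<Rightarrow> rooted_view set" where
  "view T v r = {S. \<exists>f. view_iso f (view_rep T v r) S}"

definition port_path :: "'z ptree_scheme \<Rightarrow> nat \<Rightarrow> nat list \<Rightarrow> nat list \<Rightarrow> bool" where
  "port_path T v ps xs \<longleftrightarrow>
     length xs = Suc (length ps) \<and> hd xs = v \<and>
     (\<forall>i<length ps. adj T (xs ! i) (xs ! Suc i) \<and> port T (xs ! i) (xs ! Suc i) = ps ! i)"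

definition valid_election :: "ptree \<Rightarrow> (nat \<Rightarrow> nat list) \<Rightarrow> bool" where
  "valid_election T P \<longleftrightarrow>
     (\<exists>l\<in>nodes T. \<forall>v\<in>nodes T. \<exists>xs. port_path T v (P v) xs \<and> distinct xs \<and> last xs = l)"

type_synonym oracle_advice = "ptree set \<Rightarrow> bool list"

(* None: do not halt in this round; Some p: halt with output p. *)
type_synonym decision = "rooted_view set \<Rightarrow> bool list \<Rightarrow> nat list option"

definition halt_round :: "oracle_advice \<Rightarrow> decision \<Rightarrow> ptree \<Rightarrow> nat \<Rightarrow> nat" where
  "halt_round A dec T v = (LEAST r. dec (view T v r) (A (anon_tree T)) \<noteq> None)"

definition elect_output :: "oracle_advice \<Rightarrow> decision \<Rightarrow> ptree \<Rightarrow> nat \<Rightarrow> nat list" where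
  "elect_output A dec T v = the (dec (view T v (halt_round A dec T v)) (A (anon_tree T)))"

definition solves_within :: "oracle_advice \<Rightarrow> decision \<Rightarrow> ptree \<Rightarrow> nat \<Rightarrow> bool" where
  "solves_within A dec T \<tau> \<longleftrightarrow>
     (\<forall>v\<in>nodes T. \<exists>r\<le>\<tau>. dec (view T v r) (A (anon_tree T)) \<noteq> None) \<and>
     valid_election T (elect_output A dec T)"

definition map_feasible :: "ptree \<Rightarrow> nat \<Rightarrow> bool" where
  "map_feasible T \<tau> \<longleftrightarrow>
     (\<exists>P. valid_election T P \<and>
        (\<forall>u\<in>nodes T. \<forall>v\<in>nodes T. view T u \<tau> = view T v \<tau> \<longrightarrow> P u = P v))"

(* Equal to infinity if election is infeasible even with the map, e.g. on a single edge. *)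
definition xi :: "ptree \<Rightarrow> enat" where
  "xi T = (INF \<tau>\<in>{\<tau>. map_feasible T \<tau>}. enat \<tau>)"

end

theory Submission imports Defs begin

(* On a path of length n with ports oriented consistently, the outputs of the two end nodes
   reach a common node, so their lengths add up to n. After n - 2 rounds, however, each end
   has a view that also occurs at the corresponding end of every longer path. Hence a longer
   path with the same advice would get outputs that are too short to meet, and the paths of
   lengths 2, 4, 6, ... up to D need pairwise distinct advice strings. *)

section \<open>Paths with consistently oriented ports, and their distances\<close>

text \<open>At every inner node port 0 leads towards node 0 and port 1 away from it. Node 0 has
  degree 1, so its only port must be 0 although it leads upwards; this exception is the disjunct
  \<open>u = 0\<close>.\<close>

definition path_tree :: "nat \<Rightarrow> ptree" where
  "path_tree n =
     \<lparr> nodes = {..n},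
       adj = (\<lambda>u v. u \<le> n \<and> v \<le> n \<and> (v = Suc u \<or> u = Suc v)),
       port = (\<lambda>u v. if v < u \<or> u = 0 then 0 else 1) \<rparr>"

lemma nodes_path_tree [simp]: "nodes (path_tree n) = {..n}"
  by (simp add: path_tree_def)

lemma adj_path_tree [simp]:
  "adj (path_tree n) u v \<longleftrightarrow> u \<le> n \<and> v \<le> n \<and> (v = Suc u \<or> u = Suc v)"
  by (simp add: path_tree_def)

lemma port_path_tree [simp]:
  "port (path_tree n) u v = (if v < u \<or> u = 0 then 0 else 1)"
  by (simp add: path_tree_def)

lemma neighbours_path_tree:
  assumes "v \<le> n"
  shows "{u. adj (path_tree n) v u} =
    (if v = 0 then {} else {v - 1}) \<union> (if v = n then {} else {Suc v})"
  using assms by auto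

lemma deg_path_tree:
  assumes "v \<le> n"
  shows "deg (path_tree n) v = (if v = 0 then 0 else 1) + (if v = n then 0 else 1)"
  unfolding deg_def neighbours_path_tree[OF assms] by auto

text \<open>Each edge changes the node number by one. This gives the lower bound on distances, and
  later on the lengths of outputs.\<close>

lemma successively_path_tree_length:
  assumes "successively (adj (path_tree n)) xs" "xs \<noteq> []"
  shows "\<bar>int (hd xs) - int (last xs)\<bar> < int (length xs)"
  using assms
proof (induction xs)
  case (Cons x xs)
  then show ?case by (cases xs) auto
qed simp

text \<open>Turning round would mean revisiting the node just left, so distinctness keeps the
  direction of the first step.\<close>

lemma successively_path_tree_ascending:
  assumes "successively (adj (path_tree n)) (x # xs)" "distinct (x # xs)"
    and "xs \<noteq> []" "hd xs = Suc x"
  shows "last xs = x + length xs"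
  using assms
proof (induction xs arbitrary: x)
  case (Cons y ys)
  then show ?case by (cases ys) auto
qed simp

lemma successively_path_tree_descending:
  assumes "successively (adj (path_tree n)) (x # xs)" "distinct (x # xs)"
    and "xs \<noteq> []" "x = Suc (hd xs)"
  shows "x = last xs + length xs"
  using assms
proof (induction xs arbitrary: x)
  case (Cons y ys)
  then show ?case by (cases ys) auto
qed simp

lemma distinct_walk_path_tree_length:
  assumes "successively (adj (path_tree n)) xs" "distinct xs" "xs \<noteq> []"
  shows "int (length xs) = 1 + \<bar>int (hd xs) - int (last xs)\<bar>"
proof (cases xs)
  case (Cons x ys)
  show ?thesis
  proof (cases "ys = []")
    case False
    then have "adj (path_tree n) x (hd ys)"
      using assms Cons by (cases ys) auto
    then consider "hd ys = Suc x" | "x = Suc (hd ys)" by auto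
    then show ?thesis
    proof cases
      case 1
      then have "last ys = x + length ys"
        using successively_path_tree_ascending assms Cons False by blast
      then show ?thesis using Cons False by simp
    next
      case 2
      then have "x = last ys + length ys"
        using successively_path_tree_descending assms Cons False by blast
      then show ?thesis using Cons False by simp
    qed
  qed (use Cons in simp)
qed (use assms in simp)

lemma no_cycle_path_tree: "\<not> cycle (path_tree n) xs"
proof
  assume "cycle (path_tree n) xs"
  then have xs: "length xs \<ge> 3" "distinct xs" "successively (adj (path_tree n)) xs"
    and closed: "adj (path_tree n) (last xs) (hd xs)"
    by (auto simp: cycle_def)
  \<comment> \<open>At least three distinct nodes put the two ends at distance at least 2, whereas
    the closing edge would join neighbouring numbers.\<close>
  then have "int (length xs) = 1 + \<bar>int (hd xs) - int (last xs)\<bar>"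
    by (intro distinct_walk_path_tree_length) auto
  with closed xs(1) show False by auto
qed

lemma walk_path_tree_upt:
  assumes "u \<le> v" "v \<le> n"
  shows "walk (path_tree n) u v [u..<Suc v]"
  using assms by (auto simp: walk_def successively_conv_nth hd_append simp del: upt_Suc)

lemma walk_path_tree_rev_upt:
  assumes "v \<le> u" "u \<le> n"
  shows "walk (path_tree n) u v (rev [v..<Suc u])"
  using assms
  by (auto simp: walk_def successively_conv_nth hd_rev last_rev rev_nth simp del: upt_Suc)

lemma walk_path_tree_ex:
  assumes "u \<le> n" "v \<le> n"
  shows "\<exists>xs. walk (path_tree n) u v xs \<and> length xs = Suc (nat \<bar>int u - int v\<bar>)"
proof (cases "u \<le> v")
  case True
  then show ?thesis
    using walk_path_tree_upt[OF True \<open>v \<le> n\<close>] by (intro exI[of _ "[u..<Suc v]"]) auto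
next
  case False
  then have "v \<le> u" by simp
  from walk_path_tree_rev_upt[OF this \<open>u \<le> n\<close>] False show ?thesis
    by (intro exI[of _ "rev [v..<Suc u]"]) auto
qed

lemma gdist_path_tree:
  assumes "u \<le> n" "v \<le> n"
  shows "gdist (path_tree n) u v = nat \<bar>int u - int v\<bar>"
  unfolding gdist_def
proof (rule Least_equality)
  show "\<exists>xs. walk (path_tree n) u v xs \<and> length xs = Suc (nat \<bar>int u - int v\<bar>)"
    using walk_path_tree_ex[OF assms] .
next
  fix k assume "\<exists>xs. walk (path_tree n) u v xs \<and> length xs = Suc k"
  then show "nat \<bar>int u - int v\<bar> \<le> k"
    using successively_path_tree_length unfolding walk_def by fastforce
qed

lemma port_tree_path_tree:
  assumes "n \<ge> 1"
  shows "port_tree (path_tree n)"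
proof -
  have ports: "bij_betw (port (path_tree n) v) {u. adj (path_tree n) v u} {0..<deg (path_tree n) v}"
    if "v \<le> n" for v
    unfolding neighbours_path_tree[OF that] deg_path_tree[OF that]
    using that assms by (auto simp: bij_betw_def inj_on_def)
  have walks: "\<forall>u\<in>nodes (path_tree n). \<forall>v\<in>nodes (path_tree n). \<exists>xs. walk (path_tree n) u v xs"
    using walk_path_tree_ex by (metis atMost_iff nodes_path_tree)
  show ?thesis
    unfolding port_tree_def
  proof (intro conjI)
    show "\<forall>v\<in>nodes (path_tree n).
        bij_betw (port (path_tree n) v) {u. adj (path_tree n) v u} {0..<deg (path_tree n) v}"
      using ports by (metis atMost_iff nodes_path_tree)
  qed (use walks no_cycle_path_tree in auto)
qed

lemma diam_path_tree: "diam (path_tree n) = n"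
  unfolding diam_def
proof (rule Max_eqI)
  have "{gdist (path_tree n) u v |u v. u \<in> nodes (path_tree n) \<and> v \<in> nodes (path_tree n)} \<subseteq> {..n}"
    by (auto simp: gdist_path_tree)
  then show "finite {gdist (path_tree n) u v |u v. u \<in> nodes (path_tree n) \<and> v \<in> nodes (path_tree n)}"
    by (rule finite_subset) simp
next
  have "gdist (path_tree n) 0 n = n" by (simp add: gdist_path_tree)
  then show "n \<in> {gdist (path_tree n) u v |u v. u \<in> nodes (path_tree n) \<and> v \<in> nodes (path_tree n)}"
    by (metis (mono_tags, lifting) atMost_iff le_refl mem_Collect_eq nodes_path_tree zero_le)
qed (auto simp: gdist_path_tree)

section \<open>Views as isomorphism classes\<close>

lemma view_iso_refl: "view_iso id S S"
  by (simp add: view_iso_def port_iso_def)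

lemma view_iso_trans:
  assumes "view_iso f R S" "view_iso g S U"
  shows "view_iso (g \<circ> f) R U"
proof -
  have f: "f x \<in> nodes S" if "x \<in> nodes R" for x
    using assms(1) that by (auto simp: view_iso_def port_iso_def bij_betw_def)
  have "bij_betw (g \<circ> f) (nodes R) (nodes U)"
    using assms by (auto simp: view_iso_def port_iso_def intro: bij_betw_trans)
  with f assms show ?thesis
    unfolding view_iso_def port_iso_def by simp
qed

text \<open>The inverse of \<open>f\<close> is determined only on nodes, so it is sure to send the
  root back only if the root is itself a node.\<close>

lemma view_iso_sym:
  assumes "view_iso f R S" "vroot R \<in> nodes R"
  shows "view_iso (inv_into (nodes R) f) S R"
proof -
  have bij: "bij_betw f (nodes R) (nodes S)"
    using assms(1) by (simp add: view_iso_def port_iso_def)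
  let ?g = "inv_into (nodes R) f"
  have g: "?g y \<in> nodes R" "f (?g y) = y" if "y \<in> nodes S" for y
    using bij that by (auto simp: bij_betw_def intro: inv_into_into f_inv_into_f)
  have "?g (vroot S) = vroot R"
    using assms bij by (metis bij_betw_inv_into_left view_iso_def)
  with bij_betw_inv_into[OF bij] g assms(1) show ?thesis
    unfolding view_iso_def port_iso_def by metis
qed

text \<open>Composition with the isomorphism gives one inclusion of the classes, composition with
  its inverse the other.\<close>

lemma view_eqI:
  assumes "view_iso f (view_rep S u r) (view_rep T v r)" "u \<in> nodes (view_rep S u r)"
  shows "view S u r = view T v r"
proof -
  have "vroot (view_rep S u r) = u" by (simp add: view_rep_def Let_def)
  with assms(2) view_iso_sym[OF assms(1)]
  obtain g where "view_iso g (view_rep T v r) (view_rep S u r)" by auto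
  with assms(1) show ?thesis
    unfolding view_def using view_iso_trans by blast
qed

lemma view_eqE:
  assumes "view S u r = view T v r"
  obtains f where "view_iso f (view_rep S u r) (view_rep T v r)"
proof -
  have "view_rep T v r \<in> view T v r"
    unfolding view_def using view_iso_refl by blast
  with assms that show thesis unfolding view_def by auto
qed

section \<open>Views in paths\<close>

lemma nodes_view_rep_path_tree:
  assumes "v \<le> n"
  shows "nodes (view_rep (path_tree n) v r) = {x. x \<le> n \<and> x \<le> v + r \<and> v \<le> x + r}"
  using assms by (auto simp: view_rep_def Let_def gdist_path_tree)

lemma adj_view_rep_path_tree:
  "adj (view_rep (path_tree n) v r) x y \<longleftrightarrow>
     x \<in> nodes (view_rep (path_tree n) v r) \<and> y \<in> nodes (view_rep (path_tree n) v r) \<and>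
     (y = Suc x \<or> x = Suc y)"
  by (auto simp: view_rep_def Let_def)

lemma port_view_rep_path_tree:
  "port (view_rep (path_tree n) v r) x y = (if y < x \<or> x = 0 then 0 else 1)"
  by (simp add: view_rep_def Let_def)

lemma vroot_view_rep: "vroot (view_rep T v r) = v"
  by (simp add: view_rep_def Let_def)

lemma vdeg_view_rep_path_tree:
  assumes "v \<le> n" "x \<in> nodes (view_rep (path_tree n) v r)"
  shows "vdeg (view_rep (path_tree n) v r) x =
    (if x + r = v \<or> x = v + r
     then Some ((if x = 0 then 0 else 1) + (if x = n then 0 else 1)) else None)"
proof -
  have "x \<le> n" using assms by (simp add: nodes_view_rep_path_tree)
  moreover have "nat \<bar>int v - int x\<bar> = r \<longleftrightarrow> x + r = v \<or> x = v + r" by auto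
  ultimately show ?thesis
    using assms by (auto simp: view_rep_def Let_def gdist_path_tree deg_path_tree)
qed

lemmas view_rep_path_tree_simps =
  nodes_view_rep_path_tree adj_view_rep_path_tree port_view_rep_path_tree
  vroot_view_rep vdeg_view_rep_path_tree

text \<open>As \<open>r < n\<close>, the far end lies outside the ball, so the node at distance
  \<open>r\<close> has the same degree in both paths and the identity is an isomorphism.\<close>

lemma view_path_tree_left_end:
  assumes "r < n" "n \<le> m"
  shows "view (path_tree n) 0 r = view (path_tree m) 0 r"
proof (rule view_eqI)
  have "{x. x \<le> n \<and> x \<le> r} = {x. x \<le> m \<and> x \<le> r}" using assms by auto
  then show "view_iso id (view_rep (path_tree n) 0 r) (view_rep (path_tree m) 0 r)"
    using assms by (auto simp: view_iso_def port_iso_def view_rep_path_tree_simps)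
qed (use assms in \<open>simp add: nodes_view_rep_path_tree\<close>)

text \<open>The isomorphism is the translation by \<open>m - n\<close>. As \<open>r < n\<close>,
  neither ball contains node 0, the only node whose upward port is not 1, so ports and boundary
  degrees are preserved.\<close>

lemma view_path_tree_right_end:
  assumes "r < n" "n \<le> m"
  shows "view (path_tree n) n r = view (path_tree m) m r"
proof (rule view_eqI)
  define k where "k = m - n"
  have m: "m = n + k" using assms by (simp add: k_def)
  have "bij_betw (\<lambda>x. x + k) {x. x \<le> n \<and> x \<le> n + r \<and> n \<le> x + r} {x. x \<le> m \<and> x \<le> m + r \<and> m \<le> x + r}"
    by (rule bij_betw_byWitness[where f' = "\<lambda>x. x - k"]) (use assms m in auto)
  then show "view_iso (\<lambda>x. x + k) (view_rep (path_tree n) n r) (view_rep (path_tree m) m r)"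
    using assms m by (auto simp: view_iso_def port_iso_def view_rep_path_tree_simps)
qed (use assms in \<open>simp add: nodes_view_rep_path_tree\<close>)

section \<open>Elections on two paths with the same advice\<close>

text \<open>A decision depends only on view and advice, so as long as these agree, both nodes act
  alike. One halts by round \<open>\<tau>\<close>, hence the other halts in the same round with the
  same output.\<close>

lemma elect_output_cong:
  assumes advice: "A (anon_tree S) = A (anon_tree T)"
    and views: "\<And>r. r \<le> \<tau> \<Longrightarrow> view S u r = view T v r"
    and halts: "\<exists>r\<le>\<tau>. dec (view S u r) (A (anon_tree S)) \<noteq> None"
  shows "elect_output A dec S u = elect_output A dec T v"
proof -
  define r where "r = halt_round A dec S u"
  from halts obtain r0 where r0: "r0 \<le> \<tau>" "dec (view S u r0) (A (anon_tree S)) \<noteq> None"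
    by blast
  have r: "dec (view S u r) (A (anon_tree S)) \<noteq> None"
    unfolding r_def halt_round_def using r0(2) by (rule LeastI)
  have "r \<le> r0"
    unfolding r_def halt_round_def using r0(2) by (rule Least_le)
  then have "r \<le> \<tau>" using r0(1) by simp
  have "halt_round A dec T v = r"
    unfolding halt_round_def
  proof (rule Least_equality)
    show "dec (view T v r) (A (anon_tree T)) \<noteq> None"
      using r views[OF \<open>r \<le> \<tau>\<close>] advice by simp
  next
    fix k assume k: "dec (view T v k) (A (anon_tree T)) \<noteq> None"
    show "r \<le> k"
    proof (rule ccontr)
      \<comment> \<open>A round before \<open>r\<close> is still within \<open>\<tau>\<close>, so
        the views agree there and \<open>u\<close> would already have halted.\<close>
      assume "\<not> r \<le> k"
      then have "dec (view S u k) (A (anon_tree S)) \<noteq> None"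
        using k views[of k] \<open>r \<le> \<tau>\<close> advice by simp
      then have "r \<le> k"
        unfolding r_def halt_round_def by (rule Least_le)
      with \<open>\<not> r \<le> k\<close> show False by simp
    qed
  qed
  then show ?thesis
    using views[OF \<open>r \<le> \<tau>\<close>] advice by (simp add: elect_output_def r_def[symmetric])
qed

lemma port_path_successively:
  "port_path T v ps xs \<Longrightarrow> successively (adj T) xs"
  by (auto simp: port_path_def successively_conv_nth)

text \<open>For outputs on the longer path, where a lower bound on the length suffices; the exact
  length of simple outputs comes next.\<close>

lemma port_path_path_tree_length:
  assumes "port_path (path_tree n) v ps xs"
  shows "\<bar>int v - int (last xs)\<bar> \<le> int (length ps)"
proof -
  have "length xs = Suc (length ps)" "hd xs = v" "xs \<noteq> []"
    using assms by (auto simp: port_path_def)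
  then show ?thesis
    using successively_path_tree_length[OF port_path_successively[OF assms]] by simp
qed

lemma simple_port_path_path_tree_length:
  assumes "port_path (path_tree n) v ps xs" "distinct xs"
  shows "int (length ps) = \<bar>int v - int (last xs)\<bar>"
proof -
  have "length xs = Suc (length ps)" "hd xs = v" "xs \<noteq> []"
    using assms by (auto simp: port_path_def)
  then show ?thesis
    using distinct_walk_path_tree_length[OF port_path_successively[OF assms(1)] assms(2)] by simp
qed

lemma path_trees_advice_neq:
  assumes solves_n: "solves_within A dec (path_tree n) (n - 2)"
    and solves_m: "solves_within A dec (path_tree m) (m - 2)"
    and "n \<ge> 1" "n < m"
  shows "A (anon_tree (path_tree n)) \<noteq> A (anon_tree (path_tree m))"
proof
  assume advice: "A (anon_tree (path_tree n)) = A (anon_tree (path_tree m))"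
  let ?P = "elect_output A dec (path_tree n)" and ?Q = "elect_output A dec (path_tree m)"
  \<comment> \<open>Every \<open>r\<close> up to \<open>n - 2\<close> is below \<open>n\<close>, so
    in all these rounds an end node has the same view in both paths.\<close>
  have left: "?P 0 = ?Q 0"
    using solves_n \<open>n \<ge> 1\<close> \<open>n < m\<close>
    by (intro elect_output_cong[OF advice, of "n - 2"] view_path_tree_left_end)
      (auto simp: solves_within_def)
  have right: "?P n = ?Q m"
    using solves_n \<open>n \<ge> 1\<close> \<open>n < m\<close>
    by (intro elect_output_cong[OF advice, of "n - 2"] view_path_tree_right_end)
      (auto simp: solves_within_def)
  obtain l where l: "l \<le> n"
    "\<And>v. v \<le> n \<Longrightarrow> \<exists>xs. port_path (path_tree n) v (?P v) xs \<and> distinct xs \<and> last xs = l"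
    using solves_n by (auto simp: solves_within_def valid_election_def)
  obtain l' where l': "l' \<le> m"
    "\<And>v. v \<le> m \<Longrightarrow> \<exists>xs. port_path (path_tree m) v (?Q v) xs \<and> distinct xs \<and> last xs = l'"
    using solves_m by (auto simp: solves_within_def valid_election_def)
  \<comment> \<open>The two end outputs have total length exactly \<open>n\<close> on the short
    path, but at least \<open>m\<close> on the long one.\<close>
  have "int (length (?P 0)) = int l"
    using l(2)[of 0] simple_port_path_path_tree_length by fastforce
  moreover have "int (length (?P n)) = int n - int l"
    using l(2)[of n] l(1) simple_port_path_path_tree_length by fastforce
  moreover have "int l' \<le> int (length (?Q 0))"
    using l'(2)[of 0] port_path_path_tree_length by fastforce
  moreover have "int m - int l' \<le> int (length (?Q m))"
    using l'(2)[of m] port_path_path_tree_length by fastforce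
  ultimately show False
    using left right \<open>n < m\<close> by simp
qed

section \<open>Feasibility with the map\<close>

text \<open>An isomorphism moving \<open>v\<close> to the smaller \<open>u\<close> must fail at an
  end of the path. The cases follow what the ball around \<open>v\<close> misses on the left:
  nothing for \<open>v \<le> n - 2\<close>, node 0 for \<open>v = n - 1\<close>, nodes 0 and 1 for
  \<open>v = n\<close>.\<close>

lemma view_path_tree_neq:
  assumes "n \<ge> 4" "u < v" "v \<le> n"
  shows "view (path_tree n) v (n - 2) \<noteq> view (path_tree n) u (n - 2)"
proof
  define B where "B w = {x. x \<le> n \<and> x \<le> w + (n - 2) \<and> w \<le> x + (n - 2)}" for w
  assume "view (path_tree n) v (n - 2) = view (path_tree n) u (n - 2)"
  then obtain f where
    f: "view_iso f (view_rep (path_tree n) v (n - 2)) (view_rep (path_tree n) u (n - 2))"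
    by (rule view_eqE)
  have root: "f v = u" and bij: "bij_betw f (B v) (B u)"
    using f assms by (auto simp: view_iso_def port_iso_def view_rep_path_tree_simps B_def)
  have step: "f y = Suc (f x) \<or> f x = Suc (f y)"
    if "x \<in> B v" "y \<in> B v" "y = Suc x \<or> x = Suc y" for x y
    using f assms that by (auto simp: view_iso_def port_iso_def view_rep_path_tree_simps B_def)
  have step_iff: "(y = Suc x \<or> x = Suc y) \<longleftrightarrow> (f y = Suc (f x) \<or> f x = Suc (f y))"
    if "x \<in> B v" "y \<in> B v" for x y
    using f assms that bij_betwE[OF bij]
    unfolding view_iso_def port_iso_def
    by (auto simp: view_rep_path_tree_simps B_def)
  \<comment> \<open>Port 0 marks a downward step or a step out of node 0, and isomorphisms preserve
    ports.\<close>
  have left: "y < x \<or> x = 0 \<longleftrightarrow> f y < f x \<or> f x = 0"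
    if "x \<in> B v" "y \<in> B v" "y = Suc x \<or> x = Suc y" for x y
  proof -
    have "adj (view_rep (path_tree n) v (n - 2)) x y"
      using that assms by (simp add: view_rep_path_tree_simps B_def)
    then have "port (view_rep (path_tree n) v (n - 2)) x y =
        port (view_rep (path_tree n) u (n - 2)) (f x) (f y)"
      using f that assms by (auto simp: view_iso_def port_iso_def nodes_view_rep_path_tree B_def)
    then show ?thesis
      by (auto simp: port_view_rep_path_tree split: if_splits)
  qed
  have inj: "inj_on f (B v)" using bij by (simp add: bij_betw_def)
  consider "v \<le> n - 2" | "v = n - 1" | "v = n" using assms by linarith
  then show False
  proof cases
    case 1
    \<comment> \<open>While the image is positive, port 0 leads down on both sides, so the descent
      from \<open>v\<close> is carried to the descent from \<open>u\<close>.\<close>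
    have shift: "f (v - k) = u - k" if "k \<le> u" for k
      using that
    proof (induction k)
      case (Suc k)
      have B: "v - k \<in> B v" "v - Suc k \<in> B v" and adj: "v - k = Suc (v - Suc k)"
        using Suc.prems assms 1 by (auto simp: B_def)
      have "f (v - Suc k) < f (v - k)"
        using left[OF B] adj Suc by auto
      moreover have "f (v - k) = Suc (f (v - Suc k)) \<or> f (v - Suc k) = Suc (f (v - k))"
        using step[OF B] adj by auto
      ultimately show ?case using Suc by simp
    qed (use root in simp)
    let ?x = "v - u"
    have x: "f ?x = 0" using shift[of u] by simp
    have B: "?x \<in> B v" "?x - 1 \<in> B v" "Suc ?x \<in> B v"
      using assms 1 by (auto simp: B_def)
    \<comment> \<open>The positive node \<open>v - u\<close> has two neighbours in the ball, but its
      image 0 has only the neighbour 1.\<close>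
    have "f (?x - 1) = 1" "f (Suc ?x) = 1"
      using step[OF B(1,2)] step[OF B(1,3)] x \<open>u < v\<close> by (simp_all add: Suc_diff_Suc)
    then have "?x - 1 = Suc ?x"
      using inj B by (metis inj_onD)
    then show False by simp
  next
    case 2
    \<comment> \<open>\<open>Suc (Suc u)\<close> lies within distance \<open>n - 2\<close> of
      \<open>u\<close> because \<open>n \<ge> 4\<close>.\<close>
    have B: "n - 2 \<in> B v" "n - 1 \<in> B v" "n \<in> B v" "Suc (Suc u) \<in> B u"
      using assms 2 by (auto simp: B_def)
    have "n - 1 = Suc (n - 2)" "n = Suc (n - 1)" using assms by simp_all
    have "u \<noteq> 0"
    proof
      assume "u = 0"
      then have "f (n - 2) = 1" "f n = 1"
        using step[OF B(2,1)] step[OF B(2,3)] root 2 \<open>n - 1 = Suc (n - 2)\<close> \<open>n = Suc (n - 1)\<close>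
        by auto
      then have "n - 2 = n"
        using inj B by (metis inj_onD)
      then show False using assms by simp
    qed
    then have n: "f n = Suc u"
      using step[OF B(2,3)] left[OF B(2,3)] root 2 assms by auto
    obtain y where y: "y \<in> B v" "f y = Suc (Suc u)"
      using bij B(4) by (metis bij_betw_imp_surj_on imageE)
    \<comment> \<open>The end \<open>n\<close> is sent to \<open>Suc u\<close>, so the preimage of
      \<open>Suc (Suc u)\<close> must be the only neighbour of \<open>n\<close>. That is
      \<open>v\<close>, already sent to \<open>u\<close>.\<close>
    then have "n = Suc y"
      using step_iff[OF B(3) y(1)] n by (auto simp: B_def)
    then show False using y root 2 by simp
  next
    case 3
    have B: "n - 1 \<in> B v" "n \<in> B v"
      using assms 3 by (auto simp: B_def)
    show False
    proof (cases "u = 0")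
      case True
      \<comment> \<open>The step from \<open>n - 1\<close> to \<open>n\<close> has port 1, while its
        image, the step from 1 to 0, has port 0.\<close>
      then show False
        using left[OF B(1,2)] step[OF B(1,2)] root 3 assms by auto
    next
      case False
      \<comment> \<open>Now \<open>u\<close> is an inner node with both neighbours in its ball, but
        \<open>n\<close> has only one neighbour.\<close>
      have "u - 1 \<in> B u" "Suc u \<in> B u"
        using assms False by (auto simp: B_def)
      then obtain y z where yz: "y \<in> B v" "f y = u - 1" "z \<in> B v" "f z = Suc u"
        using bij by (metis bij_betw_imp_surj_on imageE)
      then have "n = Suc y" "n = Suc z"
        using step_iff[OF B(2) yz(1)] step_iff[OF B(2) yz(3)] root 3 False by (auto simp: B_def)
      then show False using yz by simp
    qed
  qed
qed

text \<open>The degree, visible in round 0, separates the middle node from the ends. With the middle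
  as leader, both ends may output the same list, since each has its only edge at port 0.\<close>

lemma map_feasible_path_tree_2: "map_feasible (path_tree 2) 0"
proof -
  define P :: "nat \<Rightarrow> nat list" where "P v = (if v = 1 then [] else [0])" for v
  have "\<exists>xs. port_path (path_tree 2) v (P v) xs \<and> distinct xs \<and> last xs = 1" if "v \<le> 2" for v
    using that
    by (intro exI[of _ "if v = 1 then [1] else [v, 1]"]) (auto simp: port_path_def P_def)
  then have "valid_election (path_tree 2) P"
    by (auto simp: valid_election_def intro!: bexI[of _ 1])
  moreover have "P u = P v"
    if uv: "u \<le> 2" "v \<le> 2" and eq: "view (path_tree 2) u 0 = view (path_tree 2) v 0" for u v
  proof -
    obtain f where f: "view_iso f (view_rep (path_tree 2) u 0) (view_rep (path_tree 2) v 0)"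
      using eq by (rule view_eqE)
    then have "f u = v" by (simp add: view_iso_def vroot_view_rep)
    with f uv have "vdeg (view_rep (path_tree 2) u 0) u = vdeg (view_rep (path_tree 2) v 0) v"
      by (auto simp: view_iso_def nodes_view_rep_path_tree)
    then show ?thesis
      using uv by (auto simp: P_def vdeg_view_rep_path_tree nodes_view_rep_path_tree split: if_splits)
  qed
  ultimately show ?thesis
    unfolding map_feasible_def by auto
qed

lemma map_feasible_path_tree:
  assumes "n \<ge> 4"
  shows "map_feasible (path_tree n) (n - 2)"
proof -
  \<comment> \<open>All views at depth \<open>n - 2\<close> differ, so any valid outputs will do;
    here node 0 is the leader, reached by \<open>v\<close> steps through port 0.\<close>
  have "port_path (path_tree n) v (replicate v 0) (rev [0..<Suc v])" if "v \<le> n" for v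
    using that by (auto simp: port_path_def hd_rev rev_nth simp del: upt_Suc)
  then have "valid_election (path_tree n) (\<lambda>v. replicate v 0)"
    by (fastforce simp: valid_election_def last_rev hd_append simp del: upt_Suc intro!: bexI[of _ 0])
  moreover have "u = v"
    if "u \<le> n" "v \<le> n" "view (path_tree n) u (n - 2) = view (path_tree n) v (n - 2)" for u v
    using that view_path_tree_neq[OF assms] by (metis nat_neq_iff)
  ultimately show ?thesis
    unfolding map_feasible_def by (metis atMost_iff nodes_path_tree)
qed

lemma xi_path_tree:
  assumes "n \<ge> 2" "even n"
  shows "xi (path_tree n) + 2 \<le> enat n"
proof -
  \<comment> \<open>Evenness excludes 3 and leaves the two cases settled above.\<close>
  have "n = 2 \<or> n \<ge> 4" using assms by (cases "n = 3") auto
  then have "map_feasible (path_tree n) (n - 2)"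
    using map_feasible_path_tree map_feasible_path_tree_2 by auto
  then have "xi (path_tree n) \<le> enat (n - 2)"
    unfolding xi_def by (intro INF_lower) simp
  then have "xi (path_tree n) + 2 \<le> enat (n - 2) + 2"
    by (rule add_right_mono)
  also have "\<dots> = enat n"
    using assms by (simp add: numeral_eq_enat)
  finally show ?thesis .
qed

section \<open>Counting advice strings\<close>

text \<open>Pigeonhole: only \<open>2 ^ L - 1\<close> binary strings are shorter than
  \<open>L\<close>.\<close>

lemma inj_on_bool_list_length:
  fixes f :: "'a \<Rightarrow> bool list"
  assumes "inj_on f S" "finite S" "2 ^ L \<le> card S"
  shows "\<exists>x\<in>S. L \<le> length (f x)"
proof (rule ccontr)
  assume "\<not> ?thesis"
  then have short: "length (f x) < L" if "x \<in> S" for x using that by force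
  have "S \<noteq> {}" using assms by auto
  then have "L > 0" using short by fastforce
  have "card S = card (f ` S)" using assms by (simp add: card_image)
  also have "\<dots> \<le> card {xs::bool list. set xs \<subseteq> UNIV \<and> length xs \<le> L - 1}"
    using short by (intro card_mono finite_lists_length_le) fastforce+
  also have "\<dots> = (\<Sum>i\<le>L - 1. 2 ^ i)"
    by (subst card_lists_length_le) auto
  also have "\<dots> < 2 ^ L"
    using sum_power2[of L] \<open>L > 0\<close> by (simp add: atLeast0LessThan lessThan_Suc_atMost[symmetric])
  finally show False using assms by simp
qed

theorem mainTheorem3:
  "\<exists>c::real. c > 0 \<and>
     (\<forall>(A :: oracle_advice) (dec :: decision).
        (\<forall>T::ptree. port_tree T \<and> diam T > 0 \<and> even (diam T) \<longrightarrow>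
            solves_within A dec T (diam T - 2)) \<longrightarrow>
        (\<forall>D::nat. D \<ge> 4 \<longrightarrow>
            (\<exists>T::ptree. port_tree T \<and> even (diam T) \<and> diam T \<le> D \<and>
                xi T + 2 \<le> enat (diam T) \<and>
                real (length (A (anon_tree T))) \<ge> c * log 2 (real D))))"
\<comment> \<open>The advice will have length at least \<open>L\<close> for some
  \<open>L \<ge> 1\<close> with \<open>D < 2 ^ (L + 2)\<close>, and then \<open>log 2 D\<close> is
  at most \<open>L + 2\<close>, hence at most \<open>3 * L\<close>.\<close>
proof (intro exI[of _ "1/3"] conjI allI impI)
  fix A :: oracle_advice and dec :: decision and D :: nat
  assume elect: "\<forall>T::ptree. port_tree T \<and> diam T > 0 \<and> even (diam T) \<longrightarrow>
      solves_within A dec T (diam T - 2)"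
    and "D \<ge> 4"
  let ?adv = "\<lambda>h. A (anon_tree (path_tree (2 * h)))"
  have solves: "solves_within A dec (path_tree (2 * h)) (2 * h - 2)" if "h \<ge> 1" for h
    using elect[rule_format, of "path_tree (2 * h)"] that
    by (simp add: port_tree_path_tree diam_path_tree)
  have "?adv h \<noteq> ?adv k" if "1 \<le> h" "h < k" for h k
    using that path_trees_advice_neq[OF solves[of h] solves[of k]] by simp
  then have "inj_on ?adv {1..D div 2}"
    by (intro linorder_inj_onI) auto
  \<comment> \<open>\<open>L\<close> is one less than the integer part of \<open>log 2 D\<close>,
    since only the \<open>D div 2\<close> even lengths up to \<open>D\<close> are available;
    \<open>D \<ge> 4\<close> makes it positive.\<close>
  moreover obtain L where L: "2 ^ Suc L \<le> D" "D < 2 ^ Suc (Suc L)" "L \<ge> 1"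
  proof -
    obtain M where M: "2 ^ M \<le> D" "D < 2 ^ (M + 1)"
      using ex_power_ivl1[of 2 D] \<open>D \<ge> 4\<close> by auto
    have "M \<ge> 2"
    proof (rule ccontr)
      assume "\<not> M \<ge> 2"
      then have "(2::nat) ^ (M + 1) \<le> 2 ^ 2" by (intro power_increasing) auto
      with M \<open>D \<ge> 4\<close> show False by simp
    qed
    with M that[of "M - 1"] show thesis by (simp add: Suc_diff_le numeral_2_eq_2)
  qed
  moreover have "2 ^ L \<le> D div 2" using L(1) by simp
  ultimately obtain h where h: "h \<in> {1..D div 2}" "L \<le> length (?adv h)"
    using inj_on_bool_list_length[of ?adv "{1..D div 2}" L] by auto
  have "log 2 (real D) \<le> real (Suc (Suc L))"
  proof -
    have "real D \<le> 2 ^ Suc (Suc L)" using L(2)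
      by (metis less_imp_le of_nat_le_iff of_nat_numeral of_nat_power)
    then show ?thesis using \<open>D \<ge> 4\<close> by (simp add: log_le_iff powr_realpow[symmetric] powr_add)
  qed
  then have "1 / 3 * log 2 (real D) \<le> real L" using L(3) by simp
  with h show "\<exists>T::ptree. port_tree T \<and> even (diam T) \<and> diam T \<le> D \<and>
      xi T + 2 \<le> enat (diam T) \<and> real (length (A (anon_tree T))) \<ge> 1 / 3 * log 2 (real D)"
    by (intro exI[of _ "path_tree (2 * h)"])
      (auto simp: port_tree_path_tree diam_path_tree intro!: xi_path_tree)
qed simp

end
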